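(* We have $$\forall\,n\ge536,\quad \frac{1}{\sqrt{2\pi(n+\frac14)}}<\xi_{4n}\le\alpha_n\qquad\text{and}\qquad\forall\,n\ge3,\quad\alpha_n\le\xi_{n^{\#}}\le\frac{\sqrt2}{\sqrt{\pi(n-1)}},$$ where $n^{\#}:=2\left\lfloor\frac n2\right\rfloor$.
   Context: For integers $n\ge0$, $\xi_{2n}:=2^{-2n}\binom{2n}{n}$. For $n\ge2$, $f_n:[0,1]\to[0,1]$ is $f_n(t)=\sum_{j,\,0\le2j\le n}\binom{n}{2j}\binom{2j}{j}\left(\frac{1-t}{2}\right)^{2j}t^{n-2j}$, and $\alpha_n$ denotes its unique fixed point in $(0,1)$. *)

theory Defs
  imports Complex_Main
begin

(* The family is only used at even subscripts; its value at an odd subscript is irrelevant. *)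
definition xi :: "nat \<Rightarrow> real" where
  "xi m = real (m choose (m div 2)) / 2 ^ m"

lemma xi_even: "xi (2 * n) = real ((2 * n) choose n) / 2 ^ (2 * n)"
  by (simp add: xi_def)

definition f :: "nat \<Rightarrow> real \<Rightarrow> real" where
  "f n t = (\<Sum>j | 2 * j \<le> n.
     real (n choose (2 * j)) * real ((2 * j) choose j) * ((1 - t) / 2) ^ (2 * j) * t ^ (n - 2 * j))"

(* The value 1 is always a fixed point of f n, and so is 0 when n is odd; hence the open interval. *)
definition alpha :: "nat \<Rightarrow> real" where
  "alpha n = (THE t. t \<in> {0<..<1} \<and> f n t = t)"

definition hash :: "nat \<Rightarrow> nat" where
  "hash n = 2 * (n div 2)"

end

theory Submission
  imports Defs "HOL-Analysis.Analysis"
begin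

text \<open>
  Expanding the power gives \<open>f n t = 1/\<pi> \<integral> (t + (1 - t) cos 2x)^n dx\<close> over \<open>[0, \<pi>]\<close>, while \<open>xi (2 k)\<close>
  is the mean of \<open>cos x ^ (2 k)\<close>. For even \<open>n\<close>, convexity of the \<open>n\<close>-th power shows that on \<open>[0, 1/2]\<close>
  \<open>f n t\<close> is at most the corresponding combination of \<open>f n 0 = xi n\<close> and \<open>f n (1/2) = xi (2 n)\<close>,
  hence at most \<open>xi n\<close>; for odd \<open>n\<close> one has \<open>f n \<le> f (n - 1)\<close>. So \<open>f n t \<le> t\<close> at \<open>t = xi (hash n)\<close>.
  Conversely \<open>xi (4 n)\<close> is the mean of \<open>(cos\<^sup>4 x)^n\<close>, and comparing the two \<open>n\<close>-th powers by the
  tangent inequality gives \<open>f n t \<ge> t\<close> at \<open>t = xi (4 n)\<close>, up to an exponentially small term coming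
  from negative values of \<open>t + (1 - t) cos 2x\<close>. The fixed point being unique, it lies between these
  two values of \<open>t\<close>.
\<close>

subsection \<open>Wallis bounds\<close>

lemma xi_0 [simp]: "xi 0 = 1"
  by (simp add: xi_def)

lemma xi_Suc: "xi (2 * Suc m) = (2 * real m + 1) / (2 * real m + 2) * xi (2 * m)"
proof -
  have 1: "Suc m * (2 * Suc m choose Suc m) = 2 * Suc m * (Suc (2 * m) choose m)"
    using Suc_times_binomial[of m "Suc (2 * m)"] by simp
  have 2: "Suc m * (Suc (2 * m) choose m) = Suc (2 * m) * (2 * m choose m)"
    using Suc_times_binomial_add[of m m] Suc_times_binomial[of m "2 * m"]
    by (metis mult_2)
  have 1: "(real m + 1) * real (2 * Suc m choose Suc m) = 2 * (real m + 1) * real (Suc (2 * m) choose m)"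
    using arg_cong[OF 1, of real] by (simp add: algebra_simps del: binomial_Suc_Suc mult_Suc_right)
  have 2: "(real m + 1) * real (Suc (2 * m) choose m) = (2 * real m + 1) * real (2 * m choose m)"
    using arg_cong[OF 2, of real] by (simp add: algebra_simps del: binomial_Suc_Suc)
  have "x = 2 * ((2 * a + 1) * z / (a + 1))"
    if "(a + 1) * x = 2 * (a + 1) * y" "(a + 1) * y = (2 * a + 1) * z" "a \<ge> 0" for a x y z :: real
  proof -
    have "(a + 1) * x = 2 * ((2 * a + 1) * z)" unfolding that(1) that(2)[symmetric] by simp
    then show ?thesis using that(3) by (simp add: eq_divide_eq mult.commute)
  qed
  from this[OF 1 2] have "real (2 * Suc m choose Suc m) = 2 * ((2 * real m + 1) * real (2 * m choose m) / (real m + 1))"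
    by simp
  moreover have "2 * real m + 2 = 2 * (real m + 1)" by simp
  ultimately show ?thesis
    unfolding xi_even by (simp only:) (simp add: mult_ac)
qed

lemma xi_even_pos: "xi (2 * m) > 0"
  by (simp add: xi_even)

lemma xi_even_nonzero: "xi (2 * m) \<noteq> 0"
  using xi_even_pos[of m] by simp

lemma xi_even_antimono: "m \<le> k \<Longrightarrow> xi (2 * k) \<le> xi (2 * m)"
proof (induction k rule: dec_induct)
  case (step k)
  have "xi (2 * Suc k) \<le> 1 * xi (2 * k)"
    unfolding xi_Suc by (intro mult_right_mono) (auto simp: xi_even_pos less_imp_le)
  with step show ?case by simp
qed simp

lemma xi_even_le_half: "m > 0 \<Longrightarrow> xi (2 * m) \<le> 1 / 2"
  using xi_even_antimono[of 1 m] by (simp add: xi_def)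

definition wallis_prod :: "nat \<Rightarrow> real" where
  "wallis_prod m = (\<Prod>k=1..m. (4 * real k ^ 2) / (4 * real k ^ 2 - 1))"

text \<open>By \<open>xi_Suc\<close>, passing from m to m + 1 multiplies (2m + 1) xi(2m)^2 by (2m +
  1)(2m + 3) / (2m + 2)^2, which is the reciprocal of the next Wallis factor.\<close>

lemma wallis_prod_xi: "wallis_prod m * ((2 * real m + 1) * xi (2 * m) ^ 2) = 1"
proof (induction m)
  case (Suc m)
  define X where "X = xi (2 * m) ^ 2"
  define a where "a = real m"
  define c where "c = (4 * (a + 1) ^ 2) / (4 * (a + 1) ^ 2 - 1)"
  have a: "a \<ge> 0" by (simp add: a_def)
  have "(2 * a + 1) * (2 * a + 3) = 4 * (a + 1) ^ 2 - 1" "(2 * a + 2) ^ 2 = 4 * (a + 1) ^ 2"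
    by (simp_all add: algebra_simps power2_eq_square)
  moreover have "(2 * a + 1) * (2 * a + 3) > 0" using a by simp
  ultimately have "c * ((2 * a + 1) * (2 * a + 3) / (2 * a + 2) ^ 2) = 1"
    using a by (simp add: c_def)
  then have c: "c * ((2 * a + 3) * ((2 * a + 1) / (2 * a + 2)) ^ 2) = 2 * a + 1"
    using a by (simp add: power_divide power2_eq_square field_simps)
  have "wallis_prod (Suc m) * ((2 * real (Suc m) + 1) * xi (2 * Suc m) ^ 2)
      = wallis_prod m * c * ((2 * a + 3) * (((2 * a + 1) / (2 * a + 2)) ^ 2 * X))"
    unfolding xi_Suc power_mult_distrib by (simp add: wallis_prod_def c_def a_def X_def add.commute)
  also have "\<dots> = wallis_prod m * (c * ((2 * a + 3) * ((2 * a + 1) / (2 * a + 2)) ^ 2)) * X"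
    by (simp only: mult_ac)
  also have "\<dots> = 1"
    unfolding c using Suc.IH by (simp add: a_def X_def mult_ac)
  finally show ?case .
qed (simp add: wallis_prod_def)

lemma wallis_prod_lim: "wallis_prod \<longlonglongrightarrow> pi / 2"
  using wallis by (simp add: wallis_prod_def[abs_def])

lemma wallis_prod_eq: "wallis_prod m = (1 / ((2 * real m + 1) * xi (2 * m) ^ 2))"
proof -
  have "(2 * real m + 1) * xi (2 * m) ^ 2 > 0"
    using xi_even_pos[of m] by simp
  then show ?thesis
    using wallis_prod_xi[of m] by (intro eq_divide_imp) auto
qed

text \<open>All Wallis factors exceed 1, so the partial products increase to pi/2. Comparing with
  the next partial product makes the inequality strict.\<close>

lemma xi_even_gt: "1 / sqrt (pi * (real m + 1 / 2)) < xi (2 * m)"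
proof -
  have step: "wallis_prod m < wallis_prod (Suc m)" for m
  proof -
    have "wallis_prod m > 0"
      unfolding wallis_prod_eq using xi_even_pos[of m] by simp
    moreover have "4 * (real (Suc m)) ^ 2 / (4 * (real (Suc m)) ^ 2 - 1) > 1"
    proof -
      have "(real (Suc m)) ^ 2 \<ge> 1" by (intro one_le_power) auto
      then have "4 * (real (Suc m)) ^ 2 - 1 > 0" by linarith
      then show ?thesis by (subst less_divide_eq_1_pos) auto
    qed
    ultimately have "wallis_prod m * 1 < wallis_prod m * (4 * (real (Suc m)) ^ 2 / (4 * (real (Suc m)) ^ 2 - 1))"
      by (intro mult_strict_left_mono)
    then show ?thesis by (simp add: wallis_prod_def)
  qed
  then have "incseq wallis_prod" by (intro incseq_SucI less_imp_le)
  then have "wallis_prod (Suc m) \<le> pi / 2"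
    by (rule incseq_le) (rule wallis_prod_lim)
  with step[of m] have "1 / ((2 * real m + 1) * xi (2 * m) ^ 2) < pi / 2"
    unfolding wallis_prod_eq by linarith
  moreover have "0 < (2 * real m + 1) * xi (2 * m) ^ 2"
    using xi_even_pos[of m] by simp
  ultimately have "1 < pi / 2 * ((2 * real m + 1) * xi (2 * m) ^ 2)"
    by (simp only: pos_divide_less_eq)
  also have "\<dots> = xi (2 * m) ^ 2 * (pi * (real m + 1 / 2))"
    by (simp add: algebra_simps)
  finally have "1 / (pi * (real m + 1 / 2)) < xi (2 * m) ^ 2"
    by (subst pos_divide_less_eq) (auto intro: add_nonneg_pos)
  then have "sqrt (1 / (pi * (real m + 1 / 2))) < sqrt (xi (2 * m) ^ 2)"
    by (rule real_sqrt_less_mono)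
  then show ?thesis
    using xi_even_pos[of m] by (simp add: real_sqrt_divide)
qed

text \<open>Multiplying the Wallis products by 1 + 1/(2m), a factor tending to 1, turns them into a
  sequence that decreases to the same limit pi/2. Indexing by \<open>Suc k\<close> keeps m positive,
  hence \<open>m - 1\<close> below.\<close>

lemma xi_even_le:
  assumes "m > 0"
  shows "xi (2 * m) \<le> 1 / sqrt (pi * real m)"
proof -
  define c where "c k = 1 / (2 * real (Suc k) * xi (2 * Suc k) ^ 2)" for k
  have c_eq: "c k = wallis_prod (Suc k) * (1 + 1 / (2 * real (Suc k)))" for k
    unfolding wallis_prod_eq c_def using xi_even_pos[of "Suc k"] 
    by (simp add: divide_simps del: mult_Suc_right of_nat_Suc)
  have lim_half_inverse: "(\<lambda>k. 1 / (2 * real (Suc k))) \<longlonglongrightarrow> 0"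
    using tendsto_mult[OF tendsto_const[of "1/2"] lim_inverse_n'[THEN LIMSEQ_Suc]] by simp
  have "(\<lambda>k. wallis_prod (Suc k) * (1 + 1 / (2 * real (Suc k)))) \<longlonglongrightarrow> pi / 2 * (1 + 0)"
    by (intro tendsto_mult tendsto_add tendsto_const LIMSEQ_Suc[OF wallis_prod_lim] lim_half_inverse)
  then have lim: "c \<longlonglongrightarrow> pi / 2" by (simp add: c_eq[abs_def])
  have "c (Suc k) \<le> c k" for k
  proof -
    define a where "a = real (Suc k)"
    have a: "a \<ge> 0" by (simp add: a_def)
    have eq: "2 * (a + 1) = 2 * a + 2" by simp
    have gen: "b * (x / b) ^ 2 = x ^ 2 / b" for b x :: real
      by (cases "b = 0") (simp_all add: power2_eq_square)
    have "2 * a * xi (2 * Suc k) ^ 2 \<le> 2 * (a + 1) * (((2 * a + 1) / (2 * a + 2)) ^ 2 * xi (2 * Suc k) ^ 2)"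
    proof -
      have "2 * a \<le> 2 * (a + 1) * ((2 * a + 1) / (2 * a + 2)) ^ 2"
      proof -
        have "2 * (a + 1) * ((2 * a + 1) / (2 * a + 2)) ^ 2 = (2 * a + 1) ^ 2 / (2 * a + 2)"
          using gen[of "2 * a + 2"] a by (simp only: eq)
        \<comment> \<open>The monotonicity of \<open>c\<close> comes down to this: 2a + 1 is the
          mean of 2a and 2a + 2.\<close>
        moreover have "2 * a * (2 * a + 2) \<le> (2 * a + 1) ^ 2"
          by (simp add: algebra_simps power2_eq_square)
        ultimately show ?thesis
          using a by (simp add: pos_le_divide_eq)
      qed
      from mult_right_mono[OF this, of "xi (2 * Suc k) ^ 2"] show ?thesis
        by (simp add: mult.assoc)
    qed
    also have "\<dots> = 2 * real (Suc (Suc k)) * xi (2 * Suc (Suc k)) ^ 2"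
      unfolding xi_Suc[of "Suc k"] power_mult_distrib a_def by simp
    finally show ?thesis
      unfolding c_def a_def using xi_even_pos[of "Suc k"]
      by (intro divide_left_mono mult_pos_pos) (auto simp del: mult_Suc_right simp: xi_even_nonzero)
  qed
  then have "pi / 2 \<le> c (m - 1)"
    by (intro decseq_ge[OF decseq_SucI lim])
  then have "xi (2 * m) ^ 2 \<le> 1 / (pi * real m)"
    using assms xi_even_pos[of m] by (simp add: c_def field_simps)
  then have "sqrt (xi (2 * m) ^ 2) \<le> sqrt (1 / (pi * real m))"
    by (rule real_sqrt_le_mono)
  then show ?thesis
    using xi_even_pos[of m] by (simp add: real_sqrt_divide)
qed

subsection \<open>Integral representation and uniqueness of the fixed point\<close>

text \<open>Integrating the derivative of sin(ax) cos(ax)^(k+1) / a gives a two-step recursion for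
  the moments, because sin(ax) vanishes at both ends. It is the recursion \<open>xi_Suc\<close>. The
  frequencies a = 1 and a = 2 are the ones needed later.\<close>

lemma cos_power_integral:
  assumes "a > 0"
  shows "((\<lambda>x. cos (real a * x) ^ k) has_integral (if even k then pi * xi k else 0)) {0..pi}"
proof (induction k rule: induct_nat_012)
  case 0
  then show ?case using has_integral_const_real[of "1 :: real" 0 pi] by simp
next
  case 1
  have "((\<lambda>x. cos (real a * x)) has_integral (sin (real a * pi) / real a - sin (real a * 0) / real a)) {0..pi}"
    using assms by (intro fundamental_theorem_of_calculus)
      (auto intro!: derivative_eq_intros simp: has_real_derivative_iff_has_vector_derivative[symmetric])
  then show ?case by simp
next
  case (ge2 k)
  let ?c = "\<lambda>x. cos (real a * x)" and ?s = "\<lambda>x. sin (real a * x)"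
  have "((\<lambda>x. real (k + 2) * ?c x ^ (k + 2) - real (k + 1) * ?c x ^ k) has_integral
      (?s pi * ?c pi ^ (k + 1) / real a - ?s 0 * ?c 0 ^ (k + 1) / real a)) {0..pi}"
  proof (intro fundamental_theorem_of_calculus)
    fix x :: real
    have "((\<lambda>x. ?s x * ?c x ^ (k + 1) / real a) has_real_derivative
        (?c x * ?c x ^ (k + 1) - real (k + 1) * ?c x ^ k * ?s x ^ 2)) (at x within {0..pi})"
      by (rule derivative_eq_intros refl)+ (use assms in \<open>simp_all add: field_simps power2_eq_square\<close>)
    also have "?c x * ?c x ^ (k + 1) - real (k + 1) * ?c x ^ k * ?s x ^ 2
        = real (k + 2) * ?c x ^ (k + 2) - real (k + 1) * ?c x ^ k"
      unfolding sin_squared_eq by (simp add: algebra_simps power2_eq_square)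
    finally show "((\<lambda>x. ?s x * ?c x ^ (k + 1) / real a) has_vector_derivative
        real (k + 2) * ?c x ^ (k + 2) - real (k + 1) * ?c x ^ k) (at x within {0..pi})"
      by (simp add: has_real_derivative_iff_has_vector_derivative)
  qed simp
  then have "((\<lambda>x. real (k + 2) * ?c x ^ (k + 2) - real (k + 1) * ?c x ^ k) has_integral 0) {0..pi}"
    by simp
  from has_integral_add[OF this has_integral_mult_right[OF ge2.IH(1), of "real (k + 1)"]]
  have "((\<lambda>x. real (k + 2) * ?c x ^ (k + 2)) has_integral
      real (k + 1) * (if even k then pi * xi k else 0)) {0..pi}"
    by simp
  from has_integral_mult_right[OF this, of "1 / real (k + 2)"]
  have *: "((\<lambda>x. ?c x ^ (k + 2)) has_integral
      (real (k + 1) / real (k + 2) * (if even k then pi * xi k else 0))) {0..pi}"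
    by (simp add: mult.assoc del: of_nat_add of_nat_Suc)
  have "real (k + 1) / real (k + 2) * xi k = xi (k + 2)" if even: "even k"
  proof -
    from even obtain m where "k = 2 * m" by blast
    then show ?thesis using xi_Suc[of m] by (simp add: add_ac)
  qed
  then have "real (k + 1) / real (k + 2) * (if even k then pi * xi k else 0)
      = (if even (k + 2) then pi * xi (k + 2) else 0)"
    by (simp add: mult.left_commute del: of_nat_add of_nat_Suc times_divide_eq_left times_divide_eq_right)
  with * show ?case by (simp only: add_2_eq_Suc')
qed

lemma cos_even_power_integral: "((\<lambda>x. cos x ^ (2 * k)) has_integral pi * xi (2 * k)) {0..pi}"
  using cos_power_integral[of 1 "2 * k"] by simp

text \<open>In the binomial expansion the odd moments of the cosine vanish, and the even ones supply
  the central binomial coefficients of \<open>f\<close>.\<close>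

lemma f_has_integral: "((\<lambda>x. (t + (1 - t) * cos (2 * x)) ^ n) has_integral pi * f n t) {0..pi}"
proof -
  let ?m = "\<lambda>k. if even k then pi * xi k else 0"
  let ?g = "\<lambda>k. real (n choose k) * (1 - t) ^ k * t ^ (n - k) * ?m k"
  have "((\<lambda>x. \<Sum>k\<le>n. real (n choose k) * (1 - t) ^ k * t ^ (n - k) * cos (2 * x) ^ k)
      has_integral (\<Sum>k\<le>n. ?g k)) {0..pi}"
    using cos_power_integral[of 2] by (intro has_integral_sum has_integral_mult_right) auto
  moreover have "(\<Sum>k\<le>n. real (n choose k) * (1 - t) ^ k * t ^ (n - k) * cos (2 * x) ^ k)
      = (t + (1 - t) * cos (2 * x)) ^ n" for x
    unfolding add.commute[of t] binomial_ring by (simp add: power_mult_distrib mult_ac)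
  moreover have "(\<Sum>k\<le>n. ?g k) = pi * f n t"
  proof -
    have "(\<Sum>k\<le>n. ?g k) = (\<Sum>k\<in>(*) 2 ` {j. 2 * j \<le> n}. ?g k)"
      by (intro sum.mono_neutral_right) (auto elim!: evenE)
    also have "\<dots> = (\<Sum>j | 2 * j \<le> n. ?g (2 * j))"
      by (subst sum.reindex) (auto simp: inj_on_def)
    also have "\<dots> = pi * f n t"
      unfolding f_def sum_distrib_left xi_even
      by (intro sum.cong) (simp_all add: power_divide mult_ac)
    finally show ?thesis .
  qed
  ultimately show ?thesis by simp
qed

text \<open>The extra factor 1 - cos 2x is what differentiation in t brings out, so this family is
  closed under derivatives up to constants.\<close>

definition fint :: "nat \<Rightarrow> nat \<Rightarrow> real \<Rightarrow> real" where
  "fint k n t = integral {0..pi} (\<lambda>x. (1 - cos (2 * x)) ^ k * (t + (1 - t) * cos (2 * x)) ^ n)"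

lemma f_eq_fint: "f n t = fint 0 n t / pi"
  using integral_unique[OF f_has_integral[of t n]] by (simp add: fint_def)

lemma fint_deriv: "(fint k n has_real_derivative real n * fint (Suc k) (n - 1) t) (at t)"
proof -
  let ?f = "\<lambda>t x. (1 - cos (2 * x)) ^ k * (t + (1 - t) * cos (2 * x)) ^ n"
  let ?f' = "\<lambda>t x. real n * ((1 - cos (2 * x)) ^ Suc k * (t + (1 - t) * cos (2 * x)) ^ (n - 1))"
  have "((\<lambda>t. integral (cbox 0 pi) (?f t)) has_field_derivative integral (cbox 0 pi) (?f' t)) (at t within UNIV)"
  proof (rule leibniz_rule_field_derivative)
    show "((\<lambda>t. ?f t x) has_field_derivative ?f' t x) (at t within UNIV)" for t x
      by (auto intro!: derivative_eq_intros simp: algebra_simps)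
    show "?f t integrable_on cbox 0 pi" for t
      by (intro integrable_continuous continuous_intros)
    show "continuous_on (UNIV \<times> cbox 0 pi) (\<lambda>(t, x). ?f' t x)"
      unfolding case_prod_beta by (intro continuous_intros)
  qed auto
  then show ?thesis
    unfolding fint_def[abs_def] by (simp add: integral_mult_right)
qed

lemma fint_pos:
  assumes "even n" "0 < t"
  shows "0 < fint k n t"
proof -
  let ?h = "\<lambda>x. (1 - cos (2 * x)) ^ k * (t + (1 - t) * cos (2 * x)) ^ n"
  have cont: "continuous_on {0..pi} ?h" by (intro continuous_intros)
  have nonneg: "?h x \<ge> 0" for x
    using zero_le_even_power[OF assms(1)] by (intro mult_nonneg_nonneg) auto
  \<comment> \<open>At x = pi/4 the cosine of 2x is 0, and the integrand is t^n.\<close>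
  have "?h (pi / 4) \<noteq> 0" using assms by simp
  then have "fint k n t \<noteq> 0"
    unfolding fint_def using integral_eq_0_iff[OF cont] nonneg by fastforce
  moreover have "fint k n t \<ge> 0"
    unfolding fint_def using nonneg by (intro integral_nonneg integrable_continuous_real cont) auto
  ultimately show ?thesis by simp
qed

lemma Rolle_zero:
  fixes h h' :: "real \<Rightarrow> real"
  assumes "\<And>x. (h has_real_derivative h' x) (at x)" "a < b" "h a = h b"
  obtains c where "a < c" "c < b" "h' c = 0"
proof -
  have "continuous_on {a..b} h"
    using assms(1) DERIV_isCont continuous_at_imp_continuous_on by blast
  then obtain c where "a < c" "c < b" "(h has_real_derivative 0) (at c)"
    using Rolle[of a b h] assms(1) assms(2,3) real_differentiable_def by blast
  with that show thesis using DERIV_unique[OF assms(1)] by blast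
qed

lemma f_1 [simp]: "f n 1 = 1"
  by (simp add: f_eq_fint fint_def)

lemma f_0_odd: "odd n \<Longrightarrow> f n 0 = 0"
  unfolding f_def by (intro sum.neutral) (auto simp: le_less)

text \<open>A second fixed point would give, by Rolle, a zero in the open unit interval of the second
  derivative of \<open>f n\<close> if \<open>n\<close> is even, and of the third if \<open>n\<close> is odd (where \<open>0\<close> is a further
  fixed point); but these are positive, being integrals of nonnegative functions.\<close>

lemma f_fixpoint_unique:
  assumes "n \<ge> 2" "a \<in> {0<..<1}" "b \<in> {0<..<1}" "f n a = a" "f n b = b"
  shows "a = b"
proof -
  have False if ab: "a < b" "a \<in> {0<..<1}" "b \<in> {0<..<1}" "f n a = a" "f n b = b" for a b
  proof -
    \<comment> \<open>\<open>g0\<close> is pi times f n x - x, and \<open>g1\<close>,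
      \<open>g2\<close>, \<open>g3\<close> are its successive derivatives.\<close>
    define g0 where "g0 x = fint 0 n x - pi * x" for x
    define g1 where "g1 x = n * fint 1 (n - 1) x - pi" for x
    define g2 where "g2 x = n * ((n - 1) * fint 2 (n - 2) x)" for x
    define g3 where "g3 x = n * ((n - 1) * ((n - 2) * fint 3 (n - 3) x))" for x
    have d0: "(g0 has_real_derivative g1 x) (at x)" for x
      unfolding g0_def[abs_def] g1_def by (auto intro!: derivative_eq_intros fint_deriv)
    have d1: "(g1 has_real_derivative g2 x) (at x)" for x
      unfolding g1_def[abs_def] g2_def
      using fint_deriv[of 1 "n - 1" x] assms(1)
      by (auto intro!: derivative_eq_intros simp: numeral_eq_Suc)
    have d2: "(g2 has_real_derivative g3 x) (at x)" for x
      unfolding g2_def[abs_def] g3_def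
      using fint_deriv[of 2 "n - 2" x]
      by (auto intro!: derivative_eq_intros simp: numeral_eq_Suc)
    have g0: "g0 x = 0 \<longleftrightarrow> f n x = x" for x
      unfolding g0_def f_eq_fint by (auto simp: field_simps)
    have zeros: "g0 a = 0" "g0 b = 0" "g0 1 = 0"
      using ab g0 by auto
    obtain x1 where x1: "a < x1" "x1 < b" "g1 x1 = 0"
      using Rolle_zero[OF d0, of a b] ab zeros by auto
    obtain x2 where x2: "b < x2" "x2 < 1" "g1 x2 = 0"
      using Rolle_zero[OF d0, of b 1] ab zeros by auto
    obtain y where y: "x1 < y" "y < x2" "g2 y = 0"
      using Rolle_zero[OF d1, of x1 x2] x1 x2 by auto
    show False
    proof (cases "even n")
      case True
      then have "fint 2 (n - 2) y > 0" using ab x1 y by (intro fint_pos) auto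
      then show False using y(3) assms(1) by (simp add: g2_def)
    next
      case False
      then have n3: "n \<ge> 3" using assms(1) by (cases "n = 2") auto
      obtain x0 where x0: "0 < x0" "x0 < a" "g1 x0 = 0"
        using Rolle_zero[OF d0, of 0 a] ab zeros g0[of 0] f_0_odd[OF False] by auto
      obtain y0 where y0: "x0 < y0" "y0 < x1" "g2 y0 = 0"
        using Rolle_zero[OF d1, of x0 x1] x0 x1 by auto
      obtain z where z: "y0 < z" "z < y" "g3 z = 0"
        using Rolle_zero[OF d2, of y0 y] y0 y by auto
      have "fint 3 (n - 3) z > 0" using False n3 x0 y0 z by (intro fint_pos) auto
      then show False using z(3) n3 by (simp add: g3_def)
    qed
  qed
  from this[of a b] this[of b a] assms show ?thesis by (metis linorder_neqE)
qed

section \<open>Existence of the fixed point and its upper bound\<close>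

lemma f_continuous: "continuous_on S (f n)"
  unfolding f_def by (intro continuous_intros) auto

lemma f_le_xi_even:
  assumes "even n" "0 \<le> t" "t \<le> 1 / 2"
  shows "f n t \<le> xi n"
proof -
  from assms(1) obtain m where n: "n = 2 * m" by blast
  have "pi * f n t \<le> (1 - 2 * t) * (pi * xi n) + 2 * t * (pi * xi (2 * n))"
  proof (rule has_integral_le[OF f_has_integral])
    show "((\<lambda>x. (1 - 2 * t) * cos (2 * x) ^ n + 2 * t * cos x ^ (2 * n)) has_integral
        (1 - 2 * t) * (pi * xi n) + 2 * t * (pi * xi (2 * n))) {0..pi}"
      using cos_power_integral[of 2 n] assms(1)
      by (intro has_integral_add has_integral_mult_right cos_even_power_integral) auto
    fix x :: real
    \<comment> \<open>Convexity of the even power applies to this combination; \<open>cos x ^ 2\<close> is the integrand at \<open>t = 1/2\<close>.\<close>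
    have "t + (1 - t) * cos (2 * x) = (1 - 2 * t) *\<^sub>R cos (2 * x) + (2 * t) *\<^sub>R cos x ^ 2"
      unfolding cos_double_cos by (simp add: algebra_simps)
    then show "(t + (1 - t) * cos (2 * x)) ^ n
        \<le> (1 - 2 * t) * cos (2 * x) ^ n + 2 * t * cos x ^ (2 * n)"
      using convex_onD[OF convex_power_even[OF assms(1)], of "2 * t" "cos (2 * x)" "cos x ^ 2"] assms(2,3)
      by (simp add: power_mult)
  qed
  also have "\<dots> = pi * ((1 - 2 * t) * xi n + 2 * t * xi (2 * n))"
    by (simp add: algebra_simps)
  finally have "f n t \<le> (1 - 2 * t) * xi n + 2 * t * xi (2 * n)"
    by simp
  also have "\<dots> \<le> (1 - 2 * t) * xi n + 2 * t * xi n"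
    using assms(2) xi_even_antimono[of m n] n by (intro add_left_mono mult_left_mono) auto
  finally show ?thesis by (simp add: algebra_simps)
qed

lemma f_le_xi_hash:
  assumes "0 \<le> t" "t \<le> 1 / 2"
  shows "f n t \<le> xi (hash n)"
proof (cases "even n")
  case True
  then show ?thesis using f_le_xi_even[OF True assms] by (simp add: hash_def)
next
  case False
  then obtain m where n: "n = Suc (2 * m)" by (auto elim: oddE)
  have "pi * f n t \<le> pi * f (2 * m) t"
  proof (rule has_integral_le[OF f_has_integral f_has_integral])
    fix x :: real
    let ?v = "t + (1 - t) * cos (2 * x)"
    have "?v \<le> t + (1 - t) * 1" using assms by (intro add_left_mono mult_left_mono) auto
    then have "?v * ?v ^ (2 * m) \<le> 1 * ?v ^ (2 * m)"
      by (intro mult_right_mono) (auto simp: power_mult)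
    then show "?v ^ n \<le> ?v ^ (2 * m)" by (simp add: n)
  qed
  also have "\<dots> \<le> pi * xi (hash n)"
    using f_le_xi_even[of "2 * m" t] assms by (simp add: hash_def n)
  finally show ?thesis by simp
qed

text \<open>Since xi(hash n) is at most 1/2, \<open>f_le_xi_hash\<close> applies at that very point
  and gives f n t - t the sign needed at the right end; the intermediate value theorem does the
  rest. Any x with x <= f n x can serve as left end.\<close>

lemma fixpoint_exists:
  assumes "n \<ge> 2" "x \<le> xi (hash n)" "0 < x" "x \<le> f n x"
  obtains t where "x \<le> t" "t \<le> xi (hash n)" "t \<in> {0<..<1}" "f n t = t"
proof -
  have half: "0 \<le> xi (hash n)" "xi (hash n) \<le> 1 / 2"
    using assms xi_even_le_half[of "n div 2"] by (auto simp: hash_def)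
  let ?g = "\<lambda>t. f n t - t"
  have "\<exists>t. x \<le> t \<and> t \<le> xi (hash n) \<and> ?g t = 0"
  proof (rule IVT2')
    show "?g (xi (hash n)) \<le> 0" using f_le_xi_hash[OF half] by simp
    show "continuous_on {x..xi (hash n)} ?g" by (intro continuous_intros f_continuous)
  qed (use assms in auto)
  then show thesis using that half assms(3) by force
qed

text \<open>Provides a left end for \<open>fixpoint_exists\<close> arbitrarily close to 0. For even
  n this works because f n 0 > 0; for odd n, where f n 0 = 0, because the slope at 0 exceeds 1. Both
  are read off from the summand with the lowest power of t.\<close>

lemma f_ge_small:
  assumes "n \<ge> 2" "e > 0"
  obtains x where "0 < x" "x \<le> e" "x \<le> f n x"
proof -
  define c where "c = real (n choose hash n) * xi (hash n)"
  define r where "r = n - hash n"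
  have fge: "c * (1 - x) ^ hash n * x ^ r \<le> f n x" if "0 \<le> x" "x \<le> 1" for x
  proof -
    let ?F = "\<lambda>j. real (n choose (2 * j)) * real ((2 * j) choose j) * ((1 - x) / 2) ^ (2 * j) * x ^ (n - 2 * j)"
    have "?F (n div 2) \<le> (\<Sum>j | 2 * j \<le> n. ?F j)"
      using that by (intro member_le_sum) (auto intro: finite_subset[of _ "{..n}"])
    then show ?thesis
      unfolding f_def c_def r_def hash_def xi_even by (simp add: power_divide mult_ac)
  qed
  have ev: "eventually (\<lambda>x. x \<le> c * (1 - x) ^ hash n * x ^ r) (at_right 0)"
  proof (cases "even n")
    case True
    then have r: "r = 0" by (simp add: r_def hash_def)
    have "c > 0" using True xi_even_pos[of "n div 2"] by (simp add: c_def hash_def)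
    have "((\<lambda>x. c * (1 - x) ^ hash n - x) \<longlongrightarrow> c * (1 - 0) ^ hash n - 0) (at_right 0)"
      by (intro tendsto_intros)
    then have "eventually (\<lambda>x. 0 < c * (1 - x) ^ hash n - x) (at_right 0)"
      using \<open>c > 0\<close> by (intro order_tendstoD) auto
    then show ?thesis by eventually_elim (simp add: r)
  next
    case False
    then obtain m where n: "n = Suc (2 * m)" by (auto elim: oddE)
    then have m: "m > 0" using assms by auto
    have r: "r = 1" by (simp add: r_def hash_def n)
    \<comment> \<open>For n = 2m + 1 the slope is n xi(2m), and \<open>xi_even_gt\<close> reduces
      the claim to pi (m + 1/2) <= n^2. With pi < 4 this follows from 4m + 2 <= (2m + 1)^2, true for
      m >= 1.\<close>
    have "c > 1"
    proof -
      have "sqrt (pi * (real m + 1 / 2)) \<le> sqrt ((real n)\<^sup>2)"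
      proof (intro real_sqrt_le_mono)
        have "pi * (real m + 1 / 2) \<le> 4 * (real m + 1 / 2)"
          using pi_less_4 by (intro mult_right_mono) auto
        also have "\<dots> \<le> (real n)\<^sup>2"
          using mult_mono[of 1 "real m" 1 "real m"] m by (simp add: n power2_eq_square algebra_simps)
        finally show "pi * (real m + 1 / 2) \<le> (real n)\<^sup>2" .
      qed
      then have s: "sqrt (pi * (real m + 1 / 2)) \<le> real n" by simp
      have "1 = real n * (1 / real n)" using n by simp
      also have "\<dots> \<le> real n * (1 / sqrt (pi * (real m + 1 / 2)))"
        using s m by (intro mult_left_mono divide_left_mono mult_pos_pos) (auto simp: n intro!: mult_pos_pos add_nonneg_pos)
      also have "\<dots> < real n * xi (2 * m)"
        using n by (intro mult_strict_left_mono xi_even_gt) auto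
      also have "\<dots> = c" by (simp add: c_def hash_def n)
      finally show ?thesis .
    qed
    have "((\<lambda>x. c * (1 - x) ^ hash n) \<longlongrightarrow> c * (1 - 0) ^ hash n) (at_right 0)"
      by (intro tendsto_intros)
    then have "eventually (\<lambda>x. 1 < c * (1 - x) ^ hash n) (at_right 0)"
      using \<open>c > 1\<close> by (intro order_tendstoD) auto
    moreover have "eventually (\<lambda>x::real. x > 0) (at_right 0)"
      by (rule eventually_at_right_less)
    ultimately show ?thesis
      by eventually_elim (simp add: r)
  qed
  have "eventually (\<lambda>x::real. x \<in> {0<..<min e 1}) (at_right 0)"
    using assms(2) by (intro eventually_at_right_real) auto
  with ev have "eventually (\<lambda>x. 0 < x \<and> x \<le> e \<and> x \<le> f n x) (at_right 0)"
  proof eventually_elim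
    case (elim x)
    then show ?case using fge[of x] by auto
  qed
  then show thesis
    using that eventually_happens' trivial_limit_at_right_real by blast
qed

lemma alpha_eqI:
  assumes "n \<ge> 2" "t \<in> {0<..<1}" "f n t = t"
  shows "alpha n = t"
  unfolding alpha_def using assms f_fixpoint_unique by (intro the_equality) blast+

lemma le_alpha:
  assumes "n \<ge> 2" "x \<le> xi (hash n)" "0 < x" "x \<le> f n x"
  shows "x \<le> alpha n"
  using fixpoint_exists[OF assms] alpha_eqI[OF assms(1)] by metis

lemma alpha_le_xi_hash:
  assumes "n \<ge> 2"
  shows "alpha n \<le> xi (hash n)"
proof -
  have "xi (hash n) > 0" by (simp add: hash_def xi_even_pos)
  then obtain x where x: "0 < x" "x \<le> xi (hash n)" "x \<le> f n x"
    using f_ge_small[OF assms] by metis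
  from fixpoint_exists[OF assms x(2,1,3)] alpha_eqI[OF assms] show ?thesis by metis
qed

subsection \<open>The lower bound\<close>

text \<open>In the induction, a times the tangent for exponent n + 1 exceeds the tangent for
  exponent n + 2 by (n + 1) b^n (a - b)^2.\<close>

lemma power_tangent_le:
  fixes a b :: real
  assumes "0 \<le> a" "0 \<le> b"
  shows "b ^ Suc n + real (Suc n) * b ^ n * (a - b) \<le> a ^ Suc n"
proof (induction n)
  case (Suc n)
  have "b ^ Suc (Suc n) + real (Suc (Suc n)) * b ^ Suc n * (a - b)
      = a * (b ^ Suc n + real (Suc n) * b ^ n * (a - b)) - real (Suc n) * b ^ n * (a - b) ^ 2"
    by (simp add: algebra_simps power2_eq_square)
  also have "\<dots> \<le> a * (b ^ Suc n + real (Suc n) * b ^ n * (a - b))"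
    using assms by simp
  also have "\<dots> \<le> a * a ^ Suc n"
    by (rule mult_left_mono[OF Suc.IH assms(1)])
  finally show ?case by simp
qed simp

text \<open>For negative a the tangent at b has already dropped to 0 or below, so only a^(n+1) >=
  -c^(n+1) is needed. This covers odd exponents, where the power is not convex on the whole
  line.\<close>

lemma power_tangent_le_signed:
  fixes a b c :: real
  assumes "- c \<le> a" "0 \<le> b" "0 \<le> c"
  shows "b ^ Suc n + real (Suc n) * b ^ n * (a - b) - c ^ Suc n \<le> a ^ Suc n"
proof (cases "a \<ge> 0")
  case True
  then show ?thesis
    using power_tangent_le[OF True assms(2), of n] zero_le_power[OF assms(3), of "Suc n"] by linarith
next
  case False
  have "b ^ Suc n + real (Suc n) * b ^ n * (a - b) = b ^ n * (real (Suc n) * a - real n * b)"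
    by (simp add: algebra_simps)
  also have "\<dots> \<le> 0"
  proof (rule mult_nonneg_nonpos)
    have "real (Suc n) * a \<le> 0" using False by (intro mult_nonneg_nonpos) auto
    moreover have "0 \<le> real n * b" using assms(2) by simp
    ultimately show "real (Suc n) * a - real n * b \<le> 0" by linarith
  qed (use assms(2) in simp)
  finally have "b ^ Suc n + real (Suc n) * b ^ n * (a - b) \<le> 0" .
  moreover have "\<bar>a\<bar> ^ Suc n \<le> c ^ Suc n"
    using False assms by (intro power_mono) auto
  moreover have "- (\<bar>a\<bar> ^ Suc n) \<le> a ^ Suc n"
    by (metis abs_ge_minus_self minus_le_iff power_abs)
  ultimately show ?thesis by linarith
qed

text \<open>The tangent inequality is applied to \<open>a = t + (1 - t) cos 2x\<close> and \<open>b = cos\<^sup>4 x\<close>. Since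
  \<open>a - b = 2t sin\<^sup>2 x - sin\<^sup>4 x\<close>, only moments of the cosine remain.\<close>

lemma f_ge_xi:
  assumes "n \<ge> 1" "0 \<le> t" "t \<le> 1 / 2"
  shows "xi (4 * n) + real n * xi (4 * n - 4) / (4 * real n - 2) * (2 * t - 3 / (4 * real n)) - (1 - 2 * t) ^ n \<le> f n t"
proof -
  from assms(1) obtain m where n: "n = Suc m" by (cases n) auto
  define X where "X = xi (2 * (2 * m))"
  let ?Y = "xi (2 * Suc (2 * m))" and ?Z = "xi (2 * Suc (Suc (2 * m)))"
  let ?c = "\<lambda>x. cos x" and ?k = "2 * m"
  let ?L = "\<lambda>x. ?c x ^ (2 * Suc (Suc ?k)) + real n * ((2 * t - 1) * ?c x ^ (2 * ?k)
      + (2 - 2 * t) * ?c x ^ (2 * Suc ?k) - ?c x ^ (2 * Suc (Suc ?k))) - (1 - 2 * t) ^ n"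
  have "(?L has_integral pi * ?Z + real n * ((2 * t - 1) * (pi * X) + (2 - 2 * t) * (pi * ?Y) - pi * ?Z)
      - (1 - 2 * t) ^ n * pi) {0..pi}"
    unfolding X_def
    using has_integral_const_real[of "(1 - 2 * t) ^ n" 0 pi]
    by (intro has_integral_add has_integral_diff has_integral_mult_right cos_even_power_integral)
      (simp_all add: mult.commute)
  then have "pi * ?Z + real n * ((2 * t - 1) * (pi * X) + (2 - 2 * t) * (pi * ?Y) - pi * ?Z)
      - (1 - 2 * t) ^ n * pi \<le> pi * f n t"
  proof (rule has_integral_le[OF _ f_has_integral])
    fix x :: real
    define b where "b = cos x ^ 4"
    define a where "a = t + (1 - t) * cos (2 * x)"
    \<comment> \<open>The least value of a is t - (1 - t), so c = 1 - 2t in the signed tangent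
      inequality.\<close>
    have "(1 - t) * (- 1) \<le> (1 - t) * cos (2 * x)"
      using assms by (intro mult_left_mono) auto
    then have "- (1 - 2 * t) \<le> a" by (simp add: a_def)
    then have *: "b ^ Suc m + real (Suc m) * b ^ m * (a - b) - (1 - 2 * t) ^ Suc m \<le> a ^ Suc m"
      using assms by (intro power_tangent_le_signed) (auto simp: b_def)
    have ab: "a - b = (2 * t - 1) + (2 - 2 * t) * cos x ^ 2 - b"
      unfolding a_def cos_double_cos by (simp add: algebra_simps)
    define p where "p = cos x ^ (2 * ?k)"
    have "b ^ m = p"
      unfolding b_def p_def power_mult[symmetric] by simp
    moreover have "cos x ^ (2 * Suc ?k) = p * cos x ^ 2" "cos x ^ (2 * Suc (Suc ?k)) = p * b"
      unfolding p_def b_def by (simp_all add: eval_nat_numeral)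
    ultimately have "?L x = p * b + real n * (p * (a - b)) - (1 - 2 * t) ^ n"
      and "b ^ Suc m + real (Suc m) * b ^ m * (a - b) = p * b + real n * (p * (a - b))"
      unfolding ab p_def[symmetric] by (simp_all only:) (simp_all add: n algebra_simps)
    then have "?L x = b ^ Suc m + real (Suc m) * b ^ m * (a - b) - (1 - 2 * t) ^ Suc m"
      by (simp only: n)
    with * show "?L x \<le> (t + (1 - t) * cos (2 * x)) ^ n"
      unfolding a_def[symmetric] n by linarith
  qed
  moreover have "pi * ?Z + real n * ((2 * t - 1) * (pi * X) + (2 - 2 * t) * (pi * ?Y) - pi * ?Z)
      - (1 - 2 * t) ^ n * pi = pi * (?Z + real n * ((2 * t - 1) * X + (2 - 2 * t) * ?Y - ?Z) - (1 - 2 * t) ^ n)"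
    by (simp add: algebra_simps)
  ultimately have le: "?Z + real n * ((2 * t - 1) * X + (2 - 2 * t) * ?Y - ?Z) - (1 - 2 * t) ^ n \<le> f n t"
    by simp
  define a where "a = real m"
  have a: "a \<ge> 0" by (simp add: a_def)
  \<comment> \<open>The moments of orders 4n - 2 and 4n are expressed through X, the one of order 4n
    - 4, and the combination collapses to a single multiple of X.\<close>
  have Y: "?Y = (4 * a + 1) / (4 * a + 2) * X"
    unfolding xi_Suc[of ?k] by (simp add: X_def a_def)
  have Z: "?Z = (4 * a + 3) / (4 * a + 4) * ((4 * a + 1) / (4 * a + 2) * X)"
    unfolding xi_Suc[of "Suc ?k"] Y[symmetric] by (simp add: a_def add_ac)
  have "(2 * t - 1) * X + (2 - 2 * t) * ?Y - ?Z
      = X * ((2 * t - 1) + (2 - 2 * t) * ((4 * a + 1) / (4 * a + 2)) - (4 * a + 3) / (4 * a + 4) * ((4 * a + 1) / (4 * a + 2)))"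
    unfolding Z unfolding Y by (simp add: algebra_simps)
  also have "(2 * t - 1) + (2 - 2 * t) * ((4 * a + 1) / (4 * a + 2)) - (4 * a + 3) / (4 * a + 4) * ((4 * a + 1) / (4 * a + 2))
      = (2 * t - 3 / (4 * a + 4)) / (4 * a + 2)"
    using a by (simp add: divide_simps) (simp add: algebra_simps)
  finally have "(2 * t - 1) * X + (2 - 2 * t) * ?Y - ?Z = X * ((2 * t - 3 / (4 * a + 4)) / (4 * a + 2))" .
  with le have le: "?Z + real n * (X * ((2 * t - 3 / (4 * a + 4)) / (4 * a + 2))) - (1 - 2 * t) ^ n \<le> f n t"
    by simp
  have "4 * n = 2 * Suc (Suc ?k)" "4 * n - 4 = 2 * ?k" "4 * real n = 4 * a + 4" "4 * real n - 2 = 4 * a + 2"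
    by (simp_all add: n a_def)
  then show ?thesis using le by (simp add: X_def mult_ac add_ac)
qed

lemma exp_ge_power_div_fact:
  fixes x :: real
  assumes "0 \<le> x"
  shows "x ^ k / fact k \<le> exp x"
proof -
  have "(\<Sum>i\<in>{k}. inverse (fact i) * x ^ i) \<le> (\<Sum>i. inverse (fact i) * x ^ i)"
    using assms by (intro sum_le_suminf summable_exp) auto
  then show ?thesis by (simp add: exp_def divide_inverse mult.commute)
qed

text \<open>From 1 - 2t <= exp(-2t), it suffices that t^2/4 times exp(2tn) is at least 1. The degree
  6 term of the exponential series is enough: it leads to n^6 t^8 = n^2 (n t^2)^4, which the last
  hypothesis bounds below by n^2 / 7^4.\<close>

lemma one_minus_power_le:
  assumes "n \<ge> 329" "0 \<le> t" "t \<le> 1 / 2" "1 \<le> 7 * real n * t ^ 2"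
  shows "(1 - 2 * t) ^ n \<le> t ^ 2 / 4"
proof -
  define N where "N = real n"
  have N: "N \<ge> 329" using assms(1) by (simp add: N_def)
  have "(1 - 2 * t) ^ n \<le> exp (- (2 * t)) ^ n"
    using assms exp_ge_add_one_self[of "- (2 * t)"] by (intro power_mono) auto
  also have "\<dots> = 1 / exp (2 * t * N)"
    by (simp add: exp_of_nat_mult[symmetric] N_def mult_ac flip: inverse_eq_divide exp_minus)
  finally have le: "(1 - 2 * t) ^ n \<le> 1 / exp (2 * t * N)" .
  \<comment> \<open>The 45 is 4 * 6! / 2^6, and 329 is the least integer whose square reaches 45 *
    7^4 = 108045.\<close>
  have "45 * 7 ^ 4 \<le> N ^ 2"
    using power_mono[OF N, of 2] by simp
  also have "\<dots> \<le> N ^ 2 * (7 * N * t ^ 2) ^ 4"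
    using mult_left_mono[OF one_le_power[OF assms(4), of 4], of "N ^ 2"] by (simp add: N_def)
  also have "\<dots> = 7 ^ 4 * (N ^ 6 * t ^ 8)"
    by (simp add: power_mult_distrib flip: power_mult power_add)
  finally have "45 \<le> N ^ 6 * t ^ 8" by simp
  then have "1 \<le> t ^ 2 / 4 * ((2 * t * N) ^ 6 / fact 6)"
    by (simp add: power_mult_distrib fact_numeral mult_ac flip: power_add)
  also have "\<dots> \<le> t ^ 2 / 4 * exp (2 * t * N)"
    using assms(2) N by (intro mult_left_mono exp_ge_power_div_fact) auto
  finally have "1 / exp (2 * t * N) \<le> t ^ 2 / 4" by (simp add: field_simps)
  with le show ?thesis by linarith
qed

lemma xi_gt:
  "1 / sqrt (2 * pi * (real n + 1 / 4)) < xi (4 * n)"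
proof -
  have "pi * (real (2 * n) + 1 / 2) = 2 * pi * (real n + 1 / 4)"
    by (simp add: algebra_simps)
  then show ?thesis
    using xi_even_gt[of "2 * n"] by (simp only:) simp
qed

text \<open>At t = xi(4n) the leading term of \<open>f_ge_xi\<close> is t itself. The second term is
  at least t^2/4, and the exponentially small error is at most t^2/4.\<close>

lemma xi_le_f:
  assumes "n \<ge> 329"
  shows "xi (4 * n) \<le> f n (xi (4 * n))"
proof -
  define t where "t = xi (4 * n)"
  define N where "N = real n"
  have N: "N \<ge> 329" using assms by (simp add: N_def)
  have "xi (2 * (2 * n)) > 0" by (rule xi_even_pos)
  moreover have "xi (2 * (2 * n)) \<le> 1 / 2" using assms by (intro xi_even_le_half) auto
  ultimately have t: "0 < t" "t \<le> 1 / 2" by (simp_all add: t_def)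
  \<comment> \<open>Since 44/7 < 7, the shift by 1/4 is absorbed, and t^2 >= 1/(7N) follows; this is
    the form that \<open>one_minus_power_le\<close> requires.\<close>
  have "2 * pi * (N + 1 / 4) \<le> 2 * (22 / 7) * (N + 1 / 4)"
    using pi_approx N by (intro mult_mono) auto
  also have "\<dots> \<le> 7 * N" using N by simp
  finally have "2 * pi * (N + 1 / 4) \<le> 7 * N" .
  then have "1 / sqrt (7 * N) \<le> 1 / sqrt (2 * pi * (N + 1 / 4))"
    using N by (intro divide_left_mono) auto
  also have "\<dots> < t" using xi_gt[of n] by (simp add: t_def N_def)
  finally have "1 / sqrt (7 * N) \<le> t" by simp
  then have "(1 / sqrt (7 * N)) ^ 2 \<le> t ^ 2"
    using N by (intro power_mono) auto
  then have "1 / (7 * N) \<le> t ^ 2" using N by (simp add: power_divide)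
  then have t2: "1 \<le> 7 * N * t ^ 2" using N by (simp add: field_simps)
  have tN: "3 / (4 * N) \<le> t"
  proof -
    have "(3 / (4 * N)) ^ 2 = 9 / (16 * N * N)" by (simp add: power_divide power2_eq_square)
    also have "\<dots> \<le> 1 / (7 * N)" using N by (simp add: field_simps)
    also have "\<dots> \<le> t ^ 2" by fact
    finally have "(3 / (4 * N)) ^ 2 \<le> t ^ 2" .
    then show ?thesis by (rule power2_le_imp_le) (use t in simp)
  qed
  \<comment> \<open>Factors are compared one by one: N / (4N - 2) >= 1/4, xi(4n - 4) >= t by
    monotonicity, and 2t - 3/(4N) >= t by \<open>tN\<close>.\<close>
  have "t ^ 2 / 4 = 1 / 4 * t * (2 * t - t)" by (simp add: power2_eq_square)
  also have "\<dots> \<le> N * xi (4 * n - 4) / (4 * N - 2) * (2 * t - 3 / (4 * N))"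
  proof (intro mult_mono)
    have "t \<le> xi (4 * n - 4)"
      using xi_even_antimono[of "2 * n - 2" "2 * n"] by (simp add: t_def right_diff_distrib')
    then have "1 / 4 * t \<le> N / (4 * N - 2) * xi (4 * n - 4)"
      using t N by (intro mult_mono) (simp_all add: pos_le_divide_eq)
    then show "1 / 4 * t \<le> N * xi (4 * n - 4) / (4 * N - 2)" by simp
    then show "0 \<le> N * xi (4 * n - 4) / (4 * N - 2)" using t by linarith
  qed (use t tN in auto)
  moreover have "(1 - 2 * t) ^ n \<le> t ^ 2 / 4"
    using assms t t2 by (intro one_minus_power_le) (auto simp: N_def)
  moreover have "t + N * xi (4 * n - 4) / (4 * N - 2) * (2 * t - 3 / (4 * N)) - (1 - 2 * t) ^ n \<le> f n t"
    using f_ge_xi[of n t] assms t by (simp add: t_def[symmetric] N_def)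
  ultimately have "t \<le> f n t" by linarith
  then show ?thesis by (simp add: t_def)
qed

theorem proposition3p18:
  "(\<forall>n\<ge>536. 1 / sqrt (2 * pi * (real n + 1 / 4)) < xi (4 * n) \<and> xi (4 * n) \<le> alpha n) \<and>
   (\<forall>n\<ge>3. alpha n \<le> xi (hash n) \<and> xi (hash n) \<le> sqrt 2 / sqrt (pi * (real n - 1)))"
proof (intro conjI allI impI)
  fix n :: nat
  assume n: "536 \<le> n"
  show "1 / sqrt (2 * pi * (real n + 1 / 4)) < xi (4 * n)" by (rule xi_gt)
  have "xi (2 * (2 * n)) \<le> xi (2 * (n div 2))" by (rule xi_even_antimono) linarith
  then show "xi (4 * n) \<le> alpha n"
    using n xi_even_pos[of "2 * n"] by (intro le_alpha xi_le_f) (auto simp: hash_def)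
next
  fix n :: nat
  assume n: "3 \<le> n"
  then show "alpha n \<le> xi (hash n)" by (intro alpha_le_xi_hash) simp
  \<comment> \<open>Rounding n down to an even number loses at most 1, which accounts for n - 1 in
    the bound.\<close>
  have "real n - 1 \<le> 2 * real (n div 2)" by linarith
  then have "pi * (real n - 1) \<le> 2 * (pi * real (n div 2))"
    using mult_left_mono[of "real n - 1" "2 * real (n div 2)" pi] by simp
  then have "sqrt (pi * (real n - 1)) \<le> sqrt (2 * (pi * real (n div 2)))"
    by (rule real_sqrt_le_mono)
  then have "sqrt 2 / sqrt (2 * (pi * real (n div 2))) \<le> sqrt 2 / sqrt (pi * (real n - 1))"
    using n by (intro divide_left_mono) auto
  then have "1 / sqrt (pi * real (n div 2)) \<le> sqrt 2 / sqrt (pi * (real n - 1))"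
    by (simp add: real_sqrt_mult)
  moreover have "xi (hash n) \<le> 1 / sqrt (pi * real (n div 2))"
    unfolding hash_def using n by (intro xi_even_le) auto
  ultimately show "xi (hash n) \<le> sqrt 2 / sqrt (pi * (real n - 1))" by linarith
qed

end
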